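(* Let $Q$ be an acyclic quiver, $K$ an infinite field, $I$ an admissible ideal in the path algebra $KQ$, and let $M \in \mathrm{rep}_K(Q,I)$. Then the lattice $\mathcal{L}(M)$ of subrepresentations of $M$ is finite if and only if $M$ is thin.
   Context: A quiver $Q=(Q_0,Q_1,s,t)$ consists of a nonempty finite set $Q_0$ of vertices, a finite set $Q_1$ of arrows, and source and target maps $s,t\colon Q_1\to Q_0$. It is acyclic if it contains no oriented cycles. An ideal $I$ of $KQ$ is admissible if $J^m\subseteq I\subseteq J^2$ for some $m\ge 2$, where $J$ is the ideal generated by all arrows. $\mathrm{rep}_K(Q,I)$ is the category of finite-dimensional $K$-linear representations of $Q$ satisfying the relations in $I$: an object $M$ consists of finite-dimensional $K$-vector spaces $M_a$ ($a\in Q_0$) and $K$-linear maps $M_\alpha\colon M_{s(\alpha)}\to M_{t(\alpha)}$ ($\alpha\in Q_1$) satisfying the relations given by $I$; morphisms are families of linear maps commuting with the structural maps. A subrepresentation of $M$ is a family of subspaces $N_a\subseteq M_a$ with $M_\alpha(N_{s(\alpha)})\subseteq N_{t(\alpha)}$ for all $\alpha\in Q_1$. A representation $M$ is thin if $\dim_K M_a\le 1$ for every $a\in Q_0$. *)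

theory Defs
  imports
    "Graph_Theory.Arc_Walk"
    "Jordan_Normal_Form.Missing_VectorSpace"
    "HOL-Algebra.Ideal_Product"
    "HOL-Algebra.Lattice"
begin

text \<open>
  A quiver is a finite directed multigraph \<open>Q\<close> with at least one vertex; source and target are
  \<open>tail Q\<close> and \<open>head Q\<close>.
\<close>

locale quiver = fin_digraph Q for Q :: "('a, 'b) pre_digraph" +
  assumes verts_nonempty: "verts Q \<noteq> {}"

definition acyclic_quiver :: "('a, 'b) pre_digraph \<Rightarrow> bool" where
  "acyclic_quiver Q \<longleftrightarrow> (\<nexists>p. pre_digraph.cycle Q p)"

text \<open>
  A path is a pair of its starting vertex and its list of arrows in the order of traversal; the
  starting vertex distinguishes the trivial paths \<open>(a, [])\<close>.
\<close>

definition quiver_paths :: "('a, 'b) pre_digraph \<Rightarrow> ('a \<times> 'b list) set" where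
  "quiver_paths Q = {(a, p) | a p. \<exists>b. pre_digraph.awalk Q a p b}"

text \<open>
  An element of the path algebra is a finitely supported function from paths to \<open>K\<close>, extended by
  zero to all of the type. The product of two paths is \<open>(a, p) (b, q) = (a, p @ q)\<close> if \<open>p\<close> ends
  in \<open>b\<close>, and zero otherwise; so the coefficient of a product at a path is the sum over the ways
  to split that path in two. The opposite convention for composing paths gives the opposite ring,
  which has the same two-sided ideals and the same powers of the arrow ideal.
\<close>

definition path_algebra ::
    "('k, 'm) ring_scheme \<Rightarrow> ('a, 'b) pre_digraph \<Rightarrow> ('a \<times> 'b list \<Rightarrow> 'k) ring" where
  "path_algebra K Q = \<lparr>
     carrier = {f. (\<forall>x \<in> quiver_paths Q. f x \<in> carrier K)
                 \<and> (\<forall>x. x \<notin> quiver_paths Q \<longrightarrow> f x = \<zero>\<^bsub>K\<^esub>)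
                 \<and> finite {x. f x \<noteq> \<zero>\<^bsub>K\<^esub>}},
     mult = (\<lambda>f g (a, p). if (a, p) \<in> quiver_paths Q
               then \<Oplus>\<^bsub>K\<^esub>i \<in> {..length p}.
                      f (a, take i p) \<otimes>\<^bsub>K\<^esub> g (pre_digraph.awlast Q a (take i p), drop i p)
               else \<zero>\<^bsub>K\<^esub>),
     one = (\<lambda>(a, p). if a \<in> verts Q \<and> p = [] then \<one>\<^bsub>K\<^esub> else \<zero>\<^bsub>K\<^esub>),
     zero = (\<lambda>_. \<zero>\<^bsub>K\<^esub>),
     add = (\<lambda>f g x. f x \<oplus>\<^bsub>K\<^esub> g x)\<rparr>"

definition path_elem ::
    "('k, 'm) ring_scheme \<Rightarrow> 'a \<times> 'b list \<Rightarrow> ('a \<times> 'b list \<Rightarrow> 'k)" where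
  "path_elem K x = (\<lambda>y. if y = x then \<one>\<^bsub>K\<^esub> else \<zero>\<^bsub>K\<^esub>)"

definition arrow_ideal ::
    "('k, 'm) ring_scheme \<Rightarrow> ('a, 'b) pre_digraph \<Rightarrow> ('a \<times> 'b list \<Rightarrow> 'k) set" where
  "arrow_ideal K Q = Idl\<^bsub>path_algebra K Q\<^esub> ((\<lambda>e. path_elem K (tail Q e, [e])) ` arcs Q)"

text \<open>
  Since the path algebra is unital, its two-sided ideals as a ring are the same as those as a
  \<open>K\<close>-algebra. Powers are taken in the multiplicative monoid of ideals.
\<close>

definition admissible_ideal ::
    "('k, 'm) ring_scheme \<Rightarrow> ('a, 'b) pre_digraph \<Rightarrow> ('a \<times> 'b list \<Rightarrow> 'k) set \<Rightarrow> bool" where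
  "admissible_ideal K Q I \<longleftrightarrow>
     ideal I (path_algebra K Q) \<and>
     (\<exists>m::nat. m \<ge> 2
        \<and> arrow_ideal K Q [^]\<^bsub>ideals_set (path_algebra K Q)\<^esub> m \<subseteq> I
        \<and> I \<subseteq> arrow_ideal K Q [^]\<^bsub>ideals_set (path_algebra K Q)\<^esub> (2::nat))"

text \<open>
  All spaces of a representation have their elements in one type \<open>'v\<close>, but each carries its own
  carrier set, addition and scalar multiplication. Values at non-vertices and non-arrows are
  irrelevant.
\<close>

record ('a, 'b, 'k, 'v) quiver_rep =
  space_at :: "'a \<Rightarrow> ('k, 'v) module"
  map_at :: "'b \<Rightarrow> 'v \<Rightarrow> 'v"

locale representation = quiver Q for K :: "('k, 'm) ring_scheme" and Q :: "('a, 'b) pre_digraph"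
    and M :: "('a, 'b, 'k, 'v) quiver_rep" +
  assumes vectorspace_at: "a \<in> verts Q \<Longrightarrow> vectorspace K (space_at M a)"
    and fin_dim_at: "a \<in> verts Q \<Longrightarrow> vectorspace.fin_dim K (space_at M a)"
    and linear_map_at: "e \<in> arcs Q \<Longrightarrow>
      linear_map K (space_at M (tail Q e)) (space_at M (head Q e)) (map_at M e)"

text \<open>
  \<open>fold (map_at M) p\<close> is the composite of the structural maps along \<open>p\<close>. An element of \<open>I\<close> may
  involve paths with different endpoints; it is evaluated on each pair of endpoints separately.
\<close>

definition satisfies_relations ::
    "('a, 'b) pre_digraph \<Rightarrow> ('a, 'b, 'k, 'v) quiver_rep \<Rightarrow> ('k, 'm) ring_scheme
      \<Rightarrow> ('a \<times> 'b list \<Rightarrow> 'k) set \<Rightarrow> bool" where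
  "satisfies_relations Q M K I \<longleftrightarrow>
     (\<forall>r \<in> I. \<forall>a \<in> verts Q. \<forall>b \<in> verts Q. \<forall>x \<in> carrier (space_at M a).
        (\<Oplus>\<^bsub>space_at M b\<^esub>p \<in> {p. pre_digraph.awalk Q a p b \<and> r (a, p) \<noteq> \<zero>\<^bsub>K\<^esub>}.
            r (a, p) \<odot>\<^bsub>space_at M b\<^esub> fold (map_at M) p x) = \<zero>\<^bsub>space_at M b\<^esub>)"

text \<open>\<open>rep K Q I\<close> is the class of objects of the category \<open>rep\<^sub>K(Q, I)\<close>.\<close>

definition rep ::
    "('k, 'm) ring_scheme \<Rightarrow> ('a, 'b) pre_digraph \<Rightarrow> ('a \<times> 'b list \<Rightarrow> 'k) set
      \<Rightarrow> ('a, 'b, 'k, 'v) quiver_rep set" where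
  "rep K Q I = {M. representation K Q M \<and> satisfies_relations Q M K I}"

text \<open>
  A subrepresentation is an extensional family, that is, undefined outside the vertices, so that
  distinct families differ at some vertex.
\<close>

definition subrepresentations ::
    "('k, 'm) ring_scheme \<Rightarrow> ('a, 'b) pre_digraph \<Rightarrow> ('a, 'b, 'k, 'v) quiver_rep
      \<Rightarrow> ('a \<Rightarrow> 'v set) set" where
  "subrepresentations K Q M =
     {N \<in> extensional (verts Q).
        (\<forall>a \<in> verts Q. VectorSpace.subspace K (N a) (space_at M a)) \<and>
        (\<forall>e \<in> arcs Q. map_at M e ` N (tail Q e) \<subseteq> N (head Q e))}"

definition subrep_lattice ::
    "('k, 'm) ring_scheme \<Rightarrow> ('a, 'b) pre_digraph \<Rightarrow> ('a, 'b, 'k, 'v) quiver_rep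
      \<Rightarrow> ('a \<Rightarrow> 'v set) gorder" where
  "subrep_lattice K Q M = \<lparr>
     carrier = subrepresentations K Q M,
     eq = (=),
     le = (\<lambda>N N'. \<forall>a \<in> verts Q. N a \<subseteq> N' a)\<rparr>"

definition thin ::
    "('k, 'm) ring_scheme \<Rightarrow> ('a, 'b) pre_digraph \<Rightarrow> ('a, 'b, 'k, 'v) quiver_rep \<Rightarrow> bool" where
  "thin K Q M \<longleftrightarrow> (\<forall>a \<in> verts Q. vectorspace.dim K (space_at M a) \<le> 1)"


text \<open>
  Consistency of the definitions: the path algebra is a ring in which paths multiply by
  concatenation, and the subrepresentations form a lattice.
\<close>

lemma (in abelian_monoid) finsum_triangle:
  assumes "\<And>j k. j + k \<le> (n::nat) \<Longrightarrow> F j k \<in> carrier G"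
  shows "(\<Oplus>i \<in> {..n}. \<Oplus>j \<in> {..i}. F j (i - j)) = (\<Oplus>j \<in> {..n}. \<Oplus>k \<in> {..n - j}. F j k)"
  using assms
proof (induction n)
  case 0
  then show ?case by simp
next
  case (Suc n)
  have rows: "(\<Oplus>j \<in> {..n}. \<Oplus>k \<in> {..Suc n - j}. F j k)
      = (\<Oplus>j \<in> {..n}. F j (Suc n - j) \<oplus> (\<Oplus>k \<in> {..n - j}. F j k))"
  proof (rule finsum_cong')
    fix j assume "j \<in> {..n}"
    then have "Suc n - j = Suc (n - j)" by auto
    then show "(\<Oplus>k \<in> {..Suc n - j}. F j k) = F j (Suc n - j) \<oplus> (\<Oplus>k \<in> {..n - j}. F j k)"
      using Suc.prems \<open>j \<in> {..n}\<close> by (subst \<open>Suc n - j = Suc (n - j)\<close>, subst finsum_Suc) auto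
  qed (use Suc.prems in \<open>auto intro!: finsum_closed a_closed\<close>)
  have IH: "(\<Oplus>i \<in> {..n}. \<Oplus>j \<in> {..i}. F j (i - j)) = (\<Oplus>j \<in> {..n}. \<Oplus>k \<in> {..n - j}. F j k)"
    using Suc by simp
  have c1: "(\<Oplus>j \<in> {..n}. F j (Suc n - j)) \<in> carrier G"
    using Suc.prems by (auto intro!: finsum_closed)
  have c2: "(\<Oplus>j \<in> {..n}. \<Oplus>k \<in> {..n - j}. F j k) \<in> carrier G"
    using Suc.prems by (auto intro!: finsum_closed)
  have c3: "F (Suc n) 0 \<in> carrier G" using Suc.prems by simp
  have "(\<Oplus>i \<in> {..Suc n}. \<Oplus>j \<in> {..i}. F j (i - j))
      = (\<Oplus>j \<in> {..Suc n}. F j (Suc n - j)) \<oplus> (\<Oplus>i \<in> {..n}. \<Oplus>j \<in> {..i}. F j (i - j))"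
    using Suc.prems by (subst finsum_Suc) (auto intro!: finsum_closed)
  also have "(\<Oplus>j \<in> {..Suc n}. F j (Suc n - j))
      = F (Suc n) 0 \<oplus> (\<Oplus>j \<in> {..n}. F j (Suc n - j))"
    using Suc.prems by (subst finsum_Suc) auto
  also have "F (Suc n) 0 \<oplus> (\<Oplus>j \<in> {..n}. F j (Suc n - j))
        \<oplus> (\<Oplus>i \<in> {..n}. \<Oplus>j \<in> {..i}. F j (i - j))
      = F (Suc n) 0 \<oplus> ((\<Oplus>j \<in> {..n}. F j (Suc n - j)) \<oplus> (\<Oplus>j \<in> {..n}. \<Oplus>k \<in> {..n - j}. F j k))"
    unfolding IH using c1 c2 c3 by (simp add: a_assoc)
  also have "(\<Oplus>j \<in> {..n}. F j (Suc n - j)) \<oplus> (\<Oplus>j \<in> {..n}. \<Oplus>k \<in> {..n - j}. F j k)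
      = (\<Oplus>j \<in> {..n}. \<Oplus>k \<in> {..Suc n - j}. F j k)"
    unfolding rows using Suc.prems by (subst finsum_addf) (auto intro!: finsum_closed)
  also have "F (Suc n) 0 \<oplus> (\<Oplus>j \<in> {..n}. \<Oplus>k \<in> {..Suc n - j}. F j k)
      = (\<Oplus>j \<in> {..Suc n}. \<Oplus>k \<in> {..Suc n - j}. F j k)"
    using Suc.prems by (subst finsum_Suc) (auto intro!: finsum_closed)
  finally show ?case .
qed

context wf_digraph
begin

lemma quiver_paths_iff: "(a, p) \<in> quiver_paths G \<longleftrightarrow> awalk a p (awlast a p)"
  unfolding quiver_paths_def by auto

lemma quiver_paths_append_iff:
  "(a, p @ q) \<in> quiver_paths G
    \<longleftrightarrow> (a, p) \<in> quiver_paths G \<and> (awlast a p, q) \<in> quiver_paths G"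
  unfolding quiver_paths_def by auto

lemma quiver_paths_splitD:
  assumes "(a, p) \<in> quiver_paths G"
  shows "(a, take i p) \<in> quiver_paths G" "(awlast a (take i p), drop i p) \<in> quiver_paths G"
  using assms quiver_paths_append_iff[of a "take i p" "drop i p"] by auto

lemma awlast_append': "awlast a (p @ q) = awlast (awlast a p) q"
proof (induction p arbitrary: a)
  case (Cons e p)
  then show ?case by (cases p; cases q) auto
qed simp

end

lemma path_algebra_ring:
  assumes "ring K" and "fin_digraph Q"
  shows "ring (path_algebra K Q)"
proof -
  interpret ring K by fact
  interpret Q: fin_digraph Q by fact
  let ?A = "path_algebra K Q" and ?P = "quiver_paths Q"
  let ?t = "pre_digraph.awlast Q"
  have val: "f x \<in> carrier K" if "f \<in> carrier ?A" for f x
    using that by (cases x; cases "x \<in> ?P") (auto simp: path_algebra_def)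
  have off: "f x = \<zero>\<^bsub>K\<^esub>" if "f \<in> carrier ?A" "x \<notin> ?P" for f x
    using that by (cases x) (auto simp: path_algebra_def)
  have fin: "finite {x. f x \<noteq> \<zero>\<^bsub>K\<^esub>}" if "f \<in> carrier ?A" for f
    using that by (auto simp: path_algebra_def)
  have carrI: "f \<in> carrier ?A" if "\<And>x. x \<in> ?P \<Longrightarrow> f x \<in> carrier K"
    "\<And>x. x \<notin> ?P \<Longrightarrow> f x = \<zero>\<^bsub>K\<^esub>" "finite {x. f x \<noteq> \<zero>\<^bsub>K\<^esub>}" for f
    using that by (auto simp: path_algebra_def)
  have add: "(f \<oplus>\<^bsub>?A\<^esub> g) x = f x \<oplus>\<^bsub>K\<^esub> g x" for f g x by (simp add: path_algebra_def)
  have zer: "\<zero>\<^bsub>?A\<^esub> x = \<zero>\<^bsub>K\<^esub>" for x by (simp add: path_algebra_def)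
  have mul: "(f \<otimes>\<^bsub>?A\<^esub> g) (a, p) =
      (\<Oplus>\<^bsub>K\<^esub>i \<in> {..length p}. f (a, take i p) \<otimes>\<^bsub>K\<^esub> g (?t a (take i p), drop i p))"
    if "(a, p) \<in> ?P" for f g a p
    using that by (simp add: path_algebra_def)
  have mul_off: "(f \<otimes>\<^bsub>?A\<^esub> g) x = \<zero>\<^bsub>K\<^esub>" if "x \<notin> ?P" for f g x
    using that by (cases x) (simp add: path_algebra_def)
  have one: "\<one>\<^bsub>?A\<^esub> (a, p) = (if a \<in> verts Q \<and> p = [] then \<one>\<^bsub>K\<^esub> else \<zero>\<^bsub>K\<^esub>)" for a p
    by (simp add: path_algebra_def)
  have add_cl: "f \<oplus>\<^bsub>?A\<^esub> g \<in> carrier ?A" if "f \<in> carrier ?A" "g \<in> carrier ?A" for f g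
  proof (rule carrI)
    have "{x. (f \<oplus>\<^bsub>?A\<^esub> g) x \<noteq> \<zero>\<^bsub>K\<^esub>} \<subseteq> {x. f x \<noteq> \<zero>\<^bsub>K\<^esub>} \<union> {x. g x \<noteq> \<zero>\<^bsub>K\<^esub>}"
      by (auto simp: add)
    then show "finite {x. (f \<oplus>\<^bsub>?A\<^esub> g) x \<noteq> \<zero>\<^bsub>K\<^esub>}"
      using fin[OF that(1)] fin[OF that(2)] by (meson finite_Un finite_subset)
  qed (use that in \<open>auto simp: add val off\<close>)
  have mul_cl: "f \<otimes>\<^bsub>?A\<^esub> g \<in> carrier ?A" if f: "f \<in> carrier ?A" and g: "g \<in> carrier ?A" for f g
  proof (rule carrI)
    fix x assume "x \<in> ?P"
    then show "(f \<otimes>\<^bsub>?A\<^esub> g) x \<in> carrier K"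
      using val[OF f] val[OF g] by (cases x) (auto simp: mul intro!: finsum_closed)
  next
    let ?S = "{x. f x \<noteq> \<zero>\<^bsub>K\<^esub>} \<times> {x. g x \<noteq> \<zero>\<^bsub>K\<^esub>}"
    have "{x. (f \<otimes>\<^bsub>?A\<^esub> g) x \<noteq> \<zero>\<^bsub>K\<^esub>} \<subseteq> (\<lambda>((a, p), (b, q)). (a, p @ q)) ` ?S"
    proof
      fix x assume x: "x \<in> {x. (f \<otimes>\<^bsub>?A\<^esub> g) x \<noteq> \<zero>\<^bsub>K\<^esub>}"
      obtain a p where ap: "x = (a, p)" by (cases x)
      have P: "(a, p) \<in> ?P" using x mul_off ap by blast
      have "\<exists>i. f (a, take i p) \<otimes>\<^bsub>K\<^esub> g (?t a (take i p), drop i p) \<noteq> \<zero>\<^bsub>K\<^esub>"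
      proof (rule ccontr)
        assume "\<not> ?thesis"
        then have "(f \<otimes>\<^bsub>?A\<^esub> g) (a, p) = \<zero>\<^bsub>K\<^esub>" using P by (simp add: mul finsum_zero)
        then show False using x ap by simp
      qed
      then obtain i where "f (a, take i p) \<otimes>\<^bsub>K\<^esub> g (?t a (take i p), drop i p) \<noteq> \<zero>\<^bsub>K\<^esub>" ..
      then have "((a, take i p), (?t a (take i p), drop i p)) \<in> ?S"
        using val[OF f] val[OF g] by auto
      then have "(\<lambda>((a, p), (b, q)). (a, p @ q)) ((a, take i p), (?t a (take i p), drop i p))
          \<in> (\<lambda>((a, p), (b, q)). (a, p @ q)) ` ?S" by (rule imageI)
      then show "x \<in> (\<lambda>((a, p), (b, q)). (a, p @ q)) ` ?S" by (simp add: ap)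
    qed
    then show "finite {x. (f \<otimes>\<^bsub>?A\<^esub> g) x \<noteq> \<zero>\<^bsub>K\<^esub>}"
      using fin[OF f] fin[OF g] by (meson finite_SigmaI finite_imageI finite_subset)
  qed (rule mul_off)
  have mem: "(a, take i p) \<in> ?P" "(?t a (take i p), drop i p) \<in> ?P" if "(a, p) \<in> ?P" for a p i
    using Q.quiver_paths_splitD[OF that] by auto
  show ?thesis
  proof (rule ringI)
    show "abelian_group ?A"
    proof (rule abelian_groupI)
      show "\<zero>\<^bsub>?A\<^esub> \<in> carrier ?A" by (rule carrI) (auto simp: zer)
      fix f assume f: "f \<in> carrier ?A"
      let ?m = "\<lambda>x. \<ominus>\<^bsub>K\<^esub> f x"
      have "?m \<in> carrier ?A"
      proof (rule carrI)
        have "{x. ?m x \<noteq> \<zero>\<^bsub>K\<^esub>} \<subseteq> {x. f x \<noteq> \<zero>\<^bsub>K\<^esub>}" by auto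
        then show "finite {x. ?m x \<noteq> \<zero>\<^bsub>K\<^esub>}" using fin[OF f] by (rule finite_subset)
      qed (use f in \<open>auto simp: val off\<close>)
      moreover have "?m \<oplus>\<^bsub>?A\<^esub> f = \<zero>\<^bsub>?A\<^esub>" by (rule ext) (simp add: add zer val[OF f] l_neg)
      ultimately show "\<exists>g \<in> carrier ?A. g \<oplus>\<^bsub>?A\<^esub> f = \<zero>\<^bsub>?A\<^esub>" by blast
    qed (auto intro!: add_cl ext simp: add zer val a_ac)
    show "monoid ?A"
    proof (rule monoidI)
      show "\<one>\<^bsub>?A\<^esub> \<in> carrier ?A"
      proof (rule carrI)
        have "{x. \<one>\<^bsub>?A\<^esub> x \<noteq> \<zero>\<^bsub>K\<^esub>} \<subseteq> (\<lambda>a. (a, [])) ` verts Q"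
          by (auto simp: one split: if_splits)
        then show "finite {x. \<one>\<^bsub>?A\<^esub> x \<noteq> \<zero>\<^bsub>K\<^esub>}" by (rule finite_subset) simp
      qed (auto simp: one Q.quiver_paths_iff Q.awalk_Nil_iff)
    next
      fix f g h assume f: "f \<in> carrier ?A" and g: "g \<in> carrier ?A" and h: "h \<in> carrier ?A"
      show "f \<otimes>\<^bsub>?A\<^esub> g \<otimes>\<^bsub>?A\<^esub> h = f \<otimes>\<^bsub>?A\<^esub> (g \<otimes>\<^bsub>?A\<^esub> h)"
      proof (rule ext)
        fix x :: "'c \<times> 'd list"
        obtain a p where x: "x = (a, p)" by (cases x)
        show "(f \<otimes>\<^bsub>?A\<^esub> g \<otimes>\<^bsub>?A\<^esub> h) x = (f \<otimes>\<^bsub>?A\<^esub> (g \<otimes>\<^bsub>?A\<^esub> h)) x"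
        proof (cases "x \<in> ?P")
          case True
          then have P: "(a, p) \<in> ?P" by (simp add: x)
          define F where "F = (\<lambda>j k. f (a, take j p) \<otimes>\<^bsub>K\<^esub> (g (?t a (take j p), take k (drop j p))
            \<otimes>\<^bsub>K\<^esub> h (?t a (take (j + k) p), drop (j + k) p)))"
          have F: "F j k \<in> carrier K" for j k
            unfolding F_def using f g h by (auto simp: val)
          have "(f \<otimes>\<^bsub>?A\<^esub> g \<otimes>\<^bsub>?A\<^esub> h) (a, p)
              = (\<Oplus>\<^bsub>K\<^esub>i \<in> {..length p}. \<Oplus>\<^bsub>K\<^esub>j \<in> {..i}. F j (i - j))"
            unfolding mul[OF P]
          proof (rule finsum_cong')
            fix i assume "i \<in> {..length p}"
            then have i: "i \<le> length p" by simp
            have "(f \<otimes>\<^bsub>?A\<^esub> g) (a, take i p) = (\<Oplus>\<^bsub>K\<^esub>j \<in> {..i}.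
                f (a, take j p) \<otimes>\<^bsub>K\<^esub> g (?t a (take j p), take (i - j) (drop j p)))"
              unfolding mul[OF mem(1)[OF P]] using i f g
              by (intro finsum_cong') (auto simp: val min_absorb1 min_absorb2 drop_take)
            then show "(f \<otimes>\<^bsub>?A\<^esub> g) (a, take i p) \<otimes>\<^bsub>K\<^esub> h (?t a (take i p), drop i p)
                = (\<Oplus>\<^bsub>K\<^esub>j \<in> {..i}. F j (i - j))"
              using f g h by (simp add: finsum_ldistr val Pi_def F_def m_assoc cong: finsum_cong)
          qed (use F in \<open>auto intro!: finsum_closed\<close>)
          also have "\<dots> = (\<Oplus>\<^bsub>K\<^esub>j \<in> {..length p}. \<Oplus>\<^bsub>K\<^esub>k \<in> {..length p - j}. F j k)"
            by (rule finsum_triangle) (rule F)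
          also have "\<dots> = (f \<otimes>\<^bsub>?A\<^esub> (g \<otimes>\<^bsub>?A\<^esub> h)) (a, p)"
            unfolding mul[OF P]
          proof (rule finsum_cong'[symmetric])
            fix j assume "j \<in> {..length p}"
            have "?t (?t a (take j p)) (take k (drop j p)) = ?t a (take (j + k) p)"
              "drop k (drop j p) = drop (j + k) p" for k
              by (simp_all only: take_add Q.awlast_append' drop_drop add.commute)
            then have "(g \<otimes>\<^bsub>?A\<^esub> h) (?t a (take j p), drop j p) = (\<Oplus>\<^bsub>K\<^esub>k \<in> {..length p - j}.
                g (?t a (take j p), take k (drop j p))
                  \<otimes>\<^bsub>K\<^esub> h (?t a (take (j + k) p), drop (j + k) p))"
              unfolding mul[OF mem(2)[OF P]] using g h
              by (intro finsum_cong') (auto simp: val)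
            then show "f (a, take j p) \<otimes>\<^bsub>K\<^esub> (g \<otimes>\<^bsub>?A\<^esub> h) (?t a (take j p), drop j p)
                = (\<Oplus>\<^bsub>K\<^esub>k \<in> {..length p - j}. F j k)"
              using f g h by (simp add: finsum_rdistr val Pi_def F_def cong: finsum_cong)
          qed (use F in \<open>auto intro!: finsum_closed\<close>)
          finally show ?thesis by (simp add: x)
        qed (simp add: mul_off)
      qed
    next
      fix f assume f: "f \<in> carrier ?A"
      show "\<one>\<^bsub>?A\<^esub> \<otimes>\<^bsub>?A\<^esub> f = f"
      proof (rule ext)
        fix x :: "'c \<times> 'd list"
        obtain a p where x: "x = (a, p)" by (cases x)
        show "(\<one>\<^bsub>?A\<^esub> \<otimes>\<^bsub>?A\<^esub> f) x = f x"
        proof (cases "x \<in> ?P")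
          case True
          then have P: "(a, p) \<in> ?P" by (simp add: x)
          then have a: "a \<in> verts Q" by (auto simp: Q.quiver_paths_iff)
          have "(\<one>\<^bsub>?A\<^esub> \<otimes>\<^bsub>?A\<^esub> f) (a, p)
              = (\<Oplus>\<^bsub>K\<^esub>i \<in> {..length p}. if 0 = i then f (a, p) else \<zero>\<^bsub>K\<^esub>)"
            unfolding mul[OF P] using f a
            by (intro finsum_cong') (auto simp: val one)
          also have "\<dots> = f (a, p)"
            using finsum_singleton[of 0 "{..length p}" "\<lambda>_. f (a, p)"] val[OF f] by simp
          finally show ?thesis by (simp add: x)
        qed (simp add: mul_off off[OF f])
      qed
      show "f \<otimes>\<^bsub>?A\<^esub> \<one>\<^bsub>?A\<^esub> = f"
      proof (rule ext)
        fix x :: "'c \<times> 'd list"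
        obtain a p where x: "x = (a, p)" by (cases x)
        show "(f \<otimes>\<^bsub>?A\<^esub> \<one>\<^bsub>?A\<^esub>) x = f x"
        proof (cases "x \<in> ?P")
          case True
          then have P: "(a, p) \<in> ?P" by (simp add: x)
          then have b: "?t a p \<in> verts Q" by (auto simp: Q.quiver_paths_iff)
          have "(f \<otimes>\<^bsub>?A\<^esub> \<one>\<^bsub>?A\<^esub>) (a, p)
              = (\<Oplus>\<^bsub>K\<^esub>i \<in> {..length p}. if length p = i then f (a, p) else \<zero>\<^bsub>K\<^esub>)"
            unfolding mul[OF P] using f b
            by (intro finsum_cong') (auto simp: val one)
          also have "\<dots> = f (a, p)"
            using finsum_singleton[of "length p" "{..length p}" "\<lambda>_. f (a, p)"] val[OF f] by simp
          finally show ?thesis by (simp add: x)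
        qed (simp add: mul_off off[OF f])
      qed
    qed (rule mul_cl)
  next
    fix f g h assume f: "f \<in> carrier ?A" and g: "g \<in> carrier ?A" and h: "h \<in> carrier ?A"
    show "(f \<oplus>\<^bsub>?A\<^esub> g) \<otimes>\<^bsub>?A\<^esub> h = f \<otimes>\<^bsub>?A\<^esub> h \<oplus>\<^bsub>?A\<^esub> g \<otimes>\<^bsub>?A\<^esub> h"
    proof (rule ext)
      fix x :: "'c \<times> 'd list"
      obtain a p where x: "x = (a, p)" by (cases x)
      show "((f \<oplus>\<^bsub>?A\<^esub> g) \<otimes>\<^bsub>?A\<^esub> h) x = (f \<otimes>\<^bsub>?A\<^esub> h \<oplus>\<^bsub>?A\<^esub> g \<otimes>\<^bsub>?A\<^esub> h) x"
        using f g h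
        by (cases "x \<in> ?P") (auto simp: x add mul mul_off val l_distr finsum_addf Pi_def)
    qed
    show "h \<otimes>\<^bsub>?A\<^esub> (f \<oplus>\<^bsub>?A\<^esub> g) = h \<otimes>\<^bsub>?A\<^esub> f \<oplus>\<^bsub>?A\<^esub> h \<otimes>\<^bsub>?A\<^esub> g"
    proof (rule ext)
      fix x :: "'c \<times> 'd list"
      obtain a p where x: "x = (a, p)" by (cases x)
      show "(h \<otimes>\<^bsub>?A\<^esub> (f \<oplus>\<^bsub>?A\<^esub> g)) x = (h \<otimes>\<^bsub>?A\<^esub> f \<oplus>\<^bsub>?A\<^esub> h \<otimes>\<^bsub>?A\<^esub> g) x"
        using f g h
        by (cases "x \<in> ?P") (auto simp: x add mul mul_off val r_distr finsum_addf Pi_def)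
    qed
  qed
qed

lemma path_elem_mult:
  assumes "ring K" and "wf_digraph Q"
    and "(a, p) \<in> quiver_paths Q" and "(b, q) \<in> quiver_paths Q"
  shows "path_elem K (a, p) \<otimes>\<^bsub>path_algebra K Q\<^esub> path_elem K (b, q)
    = (if pre_digraph.awlast Q a p = b then path_elem K (a, p @ q) else \<zero>\<^bsub>path_algebra K Q\<^esub>)"
    (is "?l = ?r")
proof (rule ext)
  interpret ring K by fact
  interpret Q: wf_digraph Q by fact
  fix x :: "'c \<times> 'd list"
  obtain c r where x: "x = (c, r)" by (cases x)
  let ?v = "if (c, r) = (a, p @ q) \<and> pre_digraph.awlast Q a p = b then \<one>\<^bsub>K\<^esub> else \<zero>\<^bsub>K\<^esub>"
  have r: "?r x = ?v" by (auto simp: x path_elem_def path_algebra_def)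
  show "?l x = ?r x"
  proof (cases "x \<in> quiver_paths Q")
    case True
    have split: "take i r = p \<and> drop i r = q \<longleftrightarrow> i = length p \<and> r = p @ q" if "i \<le> length r" for i
      using that by (metis append_eq_conv_conj append_take_drop_id length_take min_absorb2)
    have "?l x = (\<Oplus>\<^bsub>K\<^esub>i \<in> {..length r}. if length p = i then ?v else \<zero>\<^bsub>K\<^esub>)"
    proof -
      have "path_elem K (a, p) (c, take i r)
            \<otimes>\<^bsub>K\<^esub> path_elem K (b, q) (pre_digraph.awlast Q c (take i r), drop i r)
          = (if length p = i then ?v else \<zero>\<^bsub>K\<^esub>)" if "i \<le> length r" for i
      proof (cases "take i r = p \<and> drop i r = q")
        case True
        with split[OF that] show ?thesis by (auto simp: path_elem_def)
      next
        case False
        then have "\<not> (length p = i \<and> r = p @ q)" using split[OF that] by blast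
        with False show ?thesis by (auto simp: path_elem_def)
      qed
      moreover have "?l x = (\<Oplus>\<^bsub>K\<^esub>i \<in> {..length r}. path_elem K (a, p) (c, take i r)
            \<otimes>\<^bsub>K\<^esub> path_elem K (b, q) (pre_digraph.awlast Q c (take i r), drop i r))"
        using True by (simp add: x path_algebra_def)
      ultimately show ?thesis by (simp only:) (rule finsum_cong', auto)
    qed
    also have "\<dots> = ?v"
    proof (cases "length p \<le> length r")
      case True
      then show ?thesis
        using finsum_singleton[of "length p" "{..length r}" "\<lambda>_. ?v"] by simp
    next
      case False
      then have "(\<Oplus>\<^bsub>K\<^esub>i \<in> {..length r}. if length p = i then ?v else \<zero>\<^bsub>K\<^esub>)
          = (\<Oplus>\<^bsub>K\<^esub>i \<in> {..length r}. \<zero>\<^bsub>K\<^esub>)"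
        by (intro finsum_cong') auto
      with False show ?thesis by (auto simp: finsum_zero)
    qed
    finally show ?thesis by (simp only: r)
  next
    case False
    then have "?l x = \<zero>\<^bsub>K\<^esub>" by (simp add: x path_algebra_def)
    moreover have "?v = \<zero>\<^bsub>K\<^esub>"
      using False assms(3,4) by (auto simp: x Q.quiver_paths_append_iff)
    ultimately show ?thesis by (simp only: r)
  qed
qed

lemma subrep_lattice_lattice:
  assumes "representation K Q M"
  shows "lattice (subrep_lattice K Q M)"
proof -
  interpret representation K Q M by fact
  let ?L = "subrep_lattice K Q M" and ?S = "subrepresentations K Q M"
  have L: "carrier ?L = ?S" "(.=\<^bsub>?L\<^esub>) = (=)"
    "N \<sqsubseteq>\<^bsub>?L\<^esub> N' \<longleftrightarrow> (\<forall>a \<in> verts Q. N a \<subseteq> N' a)" for N N'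
    by (auto simp: subrep_lattice_def)
  have eqI: "N = N'" if "N \<in> ?S" "N' \<in> ?S" "\<forall>a \<in> verts Q. N a = N' a" for N N'
    using that by (auto simp: subrepresentations_def intro: extensionalityI)
  have sub: "VectorSpace.subspace K (N a) (space_at M a)" if "N \<in> ?S" "a \<in> verts Q" for N a
    using that by (auto simp: subrepresentations_def)
  have mp: "map_at M e x \<in> N (head Q e)" if "N \<in> ?S" "e \<in> arcs Q" "x \<in> N (tail Q e)" for N e x
    using that by (auto simp: subrepresentations_def)
  have po: "partial_order ?L"
    by unfold_locales (auto simp: L intro!: eqI)
  have submod: "LinearCombinations.submodule K (N a) (space_at M a)"
    if "N \<in> ?S" "a \<in> verts Q" for N a
    using sub[OF that] by (simp add: VectorSpace.subspace_def)
  have md: "module K (space_at M a)" if "a \<in> verts Q" for a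
    using vectorspace_at[OF that] by (simp add: vectorspace_def)
  have lower: "\<exists>s. greatest ?L s (Lower ?L {N, N'})" if N: "N \<in> ?S" and N': "N' \<in> ?S" for N N'
  proof -
    let ?s = "restrict (\<lambda>a. N a \<inter> N' a) (verts Q)"
    have s: "?s \<in> ?S"
      unfolding subrepresentations_def
    proof (intro CollectI IntI conjI ballI)
      fix a assume a: "a \<in> verts Q"
      show "VectorSpace.subspace K (?s a) (space_at M a)"
        using submod[OF N a] submod[OF N' a] vectorspace_at[OF a] a
        by (auto simp: VectorSpace.subspace_def LinearCombinations.submodule_def)
    qed (use mp[OF N] mp[OF N'] in auto)
    then have "greatest ?L ?s (Lower ?L {N, N'})"
      using N N' by (auto simp: greatest_def Lower_def L)
    then show ?thesis by blast
  qed
  have upper: "\<exists>s. least ?L s (Upper ?L {N, N'})" if N: "N \<in> ?S" and N': "N' \<in> ?S" for N N'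
  proof -
    let ?s = "restrict (\<lambda>a. module.submodule_sum (space_at M a) (N a) (N' a)) (verts Q)"
    have s: "?s \<in> ?S"
      unfolding subrepresentations_def
    proof (intro CollectI IntI conjI ballI)
      fix a assume a: "a \<in> verts Q"
      show "VectorSpace.subspace K (?s a) (space_at M a)"
        using vectorspace.sum_is_subspace[OF vectorspace_at[OF a] sub[OF N a] sub[OF N' a]] a
        by simp
    next
      fix e assume e: "e \<in> arcs Q"
      interpret f: linear_map K "space_at M (tail Q e)" "space_at M (head Q e)" "map_at M e"
        using e by (rule linear_map_at)
      have "N (tail Q e) \<subseteq> carrier (space_at M (tail Q e))"
        "N' (tail Q e) \<subseteq> carrier (space_at M (tail Q e))"
        using submod[OF N] submod[OF N'] e by (auto simp: LinearCombinations.submodule_def)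
      then show "map_at M e ` ?s (tail Q e) \<subseteq> ?s (head Q e)"
        using e mp[OF N e] mp[OF N' e]
        by (force simp: module.submodule_sum_def[OF md] subset_iff)
    qed simp
    have "?s \<in> Upper ?L {N, N'}"
      using s N N' module.in_sum[OF md submod[OF N] submod[OF N']]
        module.in_sum[OF md submod[OF N'] submod[OF N]]
        module.msum_comm[OF md submod[OF N] submod[OF N']]
      by (auto simp: Upper_def L subset_iff)
    moreover have "?s \<sqsubseteq>\<^bsub>?L\<^esub> U" if "U \<in> Upper ?L {N, N'}" for U
    proof -
      have U: "U \<in> ?S" "\<forall>a \<in> verts Q. N a \<subseteq> U a" "\<forall>a \<in> verts Q. N' a \<subseteq> U a"
        using that N N' by (auto simp: Upper_def L)
      then show ?thesis
        using module.sum_is_minimal[OF md submod[OF N] submod[OF N'] submod[OF U(1)]]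
        by (simp add: L)
    qed
    ultimately have "least ?L ?s (Upper ?L {N, N'})"
      by (auto simp: least_def Upper_def)
    then show ?thesis by blast
  qed
  show ?thesis
    using po lower upper
    by (auto simp: lattice_def upper_semilattice_def lower_semilattice_def
        upper_semilattice_axioms_def lower_semilattice_axioms_def L)
qed

end

theory Submission
  imports Defs
begin

text \<open>
  A space of dimension at most one has only the subspaces \<open>0\<close> and itself, whereas a space of
  larger dimension contains two independent vectors \<open>v\<close>, \<open>w\<close> and hence, over an infinite field,
  infinitely many lines spanned by \<open>w + c v\<close>. So thin representations have finitely many
  subrepresentations. Conversely, at a vertex \<open>a\<close> of an acyclic quiver every subspace \<open>U\<close> of
  \<open>M\<^sub>a\<close> occurs in a subrepresentation: take \<open>U\<close> at \<open>a\<close>, the whole space at the other vertices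
  reachable from \<open>a\<close>, and zero elsewhere.
\<close>

lemma (in abelian_group) add_eq_add_imp_minus_eq:
  assumes "p \<in> carrier G" "q \<in> carrier G" "r \<in> carrier G" "s \<in> carrier G"
    and "p \<oplus> q = r \<oplus> s"
  shows "p \<ominus> r = s \<ominus> q"
proof -
  have "p \<ominus> r = (p \<oplus> q) \<ominus> (r \<oplus> q)"
    using assms(1-4) by (simp add: minus_eq minus_add a_ac r_neg1 r_neg2)
  also have "\<dots> = (s \<oplus> r) \<ominus> (r \<oplus> q)"
    unfolding assms(5) using assms(3,4) by (simp add: a_comm)
  also have "\<dots> = s \<ominus> q"
    using assms(1-4) by (simp add: minus_eq minus_add a_assoc r_neg1 r_neg2)
  finally show ?thesis .
qed

context vectorspace
begin

lemma span_singleton: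
  assumes "v \<in> carrier V"
  shows "span {v} = (\<lambda>c. c \<odot>\<^bsub>V\<^esub> v) ` carrier K"
proof -
  have "lincomb f {v} = f v \<odot>\<^bsub>V\<^esub> v" if "f v \<in> carrier K" for f
    using that assms by (simp add: lincomb_def)
  then have "span {v} = {f v \<odot>\<^bsub>V\<^esub> v | f. f v \<in> carrier K}"
    using assms by (subst finite_span) (auto, metis+)
  also have "\<dots> = (\<lambda>c. c \<odot>\<^bsub>V\<^esub> v) ` carrier K"
    \<comment> \<open>A scalar c is the coefficient of v under the constant function with value
      c.\<close>
    by (auto intro: exI[of _ "\<lambda>_. c" for c])
  finally show ?thesis .
qed

lemma smult_diff_left:
  assumes "c \<in> carrier K" "d \<in> carrier K" "v \<in> carrier V"
  shows "(c \<ominus>\<^bsub>K\<^esub> d) \<odot>\<^bsub>V\<^esub> v = c \<odot>\<^bsub>V\<^esub> v \<ominus>\<^bsub>V\<^esub> d \<odot>\<^bsub>V\<^esub> v"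
  using assms by (simp add: R.minus_eq M.minus_eq smult_l_distr smult_l_minus)

text \<open>Replaces a bound on cardinalities of bases by a concrete generator: v may be zero, so
  dimensions zero and one are handled together.\<close>

lemma dim_le_one_iff:
  assumes "fin_dim"
  shows "dim \<le> 1 \<longleftrightarrow> (\<exists>v \<in> carrier V. span {v} = carrier V)"
proof
  assume "\<exists>v \<in> carrier V. span {v} = carrier V"
  then obtain v where "v \<in> carrier V" "span {v} = carrier V" by blast
  then show "dim \<le> 1" using gen_ge_dim[of "{v}"] by simp
next
  assume le: "dim \<le> 1"
  obtain B where B: "finite B" "basis B" using finite_basis_exists[OF assms] by blast
  then have gen: "B \<subseteq> carrier V" "span B = carrier V" by (auto simp: basis_def)
  have "card B \<le> 1" using le dim_basis[OF B] by simp
  then consider "B = {}" | v where "B = {v}"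
    using B(1) by (metis One_nat_def card_0_eq card_1_singletonE le_Suc_eq le_zero_eq)
  then show "\<exists>v \<in> carrier V. span {v} = carrier V"
  proof cases
    case 1
    \<comment> \<open>The empty basis offers no vector, but the zero vector generates the zero space
      as well.\<close>
    have "span {} \<subseteq> span {\<zero>\<^bsub>V\<^esub>}" by (rule span_is_monotone) simp
    moreover have "span {\<zero>\<^bsub>V\<^esub>} \<subseteq> carrier V" by (auto simp: span_singleton)
    ultimately show ?thesis using gen 1 by (intro bexI[of _ "\<zero>\<^bsub>V\<^esub>"]) auto
  next
    case 2
    then show ?thesis using gen by auto
  qed
qed

lemma subspace_whole: "subspace K (carrier V) V"
  by unfold_locales auto

lemma subspace_zero: "subspace K {\<zero>\<^bsub>V\<^esub>} V"
  by unfold_locales auto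

text \<open>A nonzero w in W is c v with c invertible, so W contains v and with it the whole
  line.\<close>

lemma subspace_of_line:
  assumes v: "v \<in> carrier V" "span {v} = carrier V" and W: "subspace K W V"
  shows "W = {\<zero>\<^bsub>V\<^esub>} \<or> W = carrier V"
proof (rule disjCI)
  interpret W: LinearCombinations.submodule K W V
    using W by (simp add: VectorSpace.subspace_def)
  assume "W \<noteq> carrier V"
  moreover have "W = carrier V" if "w \<in> W" "w \<noteq> \<zero>\<^bsub>V\<^esub>" for w
  proof -
    have "w \<in> span {v}" using that W.subset v by auto
    then obtain c where c: "c \<in> carrier K" "c \<odot>\<^bsub>V\<^esub> v = w"
      unfolding span_singleton[OF v(1)] by blast
    have "c \<noteq> \<zero>\<^bsub>K\<^esub>" using that c v by auto
    then have "v = inv\<^bsub>K\<^esub> c \<odot>\<^bsub>V\<^esub> w" "inv\<^bsub>K\<^esub> c \<in> carrier K"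
      using mult_inverse[OF c(1) v(1) c(2)] c(1) field_Units by auto
    then have "v \<in> W" using that W.smult_closed by metis
    then have "span {v} \<subseteq> W" unfolding span_singleton[OF v(1)] by auto
    then show ?thesis using v W.subset by auto
  qed
  ultimately show "W = {\<zero>\<^bsub>V\<^esub>}" using W.zero_closed by blast
qed

lemma finite_subspaces_iff:
  assumes "infinite (carrier K)" and "fin_dim"
  shows "finite {W. subspace K W V} \<longleftrightarrow> dim \<le> 1"
proof
  assume "dim \<le> 1"
  then obtain v where "v \<in> carrier V" "span {v} = carrier V"
    using dim_le_one_iff[OF assms(2)] by blast
  then have "{W. subspace K W V} \<subseteq> {{\<zero>\<^bsub>V\<^esub>}, carrier V}" using subspace_of_line by blast
  then show "finite {W. subspace K W V}" by (rule finite_subset) simp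
next
  assume fin: "finite {W. subspace K W V}"
  show "dim \<le> 1"
  proof (rule ccontr)
    assume "\<not> dim \<le> 1"
    then have proper: "\<exists>w \<in> carrier V. w \<notin> span {v}" if "v \<in> carrier V" for v
      using that span_is_subset2[of "{v}"] dim_le_one_iff[OF assms(2)] by blast
    \<comment> \<open>Since no single vector generates V, some vector lies outside the span of zero;
      it serves as v, and w is then chosen outside the line of v.\<close>
    obtain v where v: "v \<in> carrier V" "v \<noteq> \<zero>\<^bsub>V\<^esub>"
      using proper[of "\<zero>\<^bsub>V\<^esub>"] by (force simp: span_singleton)
    obtain w where w: "w \<in> carrier V" "w \<notin> span {v}" using proper[OF v(1)] by blast
    let ?x = "\<lambda>c. w \<oplus>\<^bsub>V\<^esub> c \<odot>\<^bsub>V\<^esub> v"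
    \<comment> \<open>If two of the lines coincide, then w + c v = m (w + d v) for some scalar m,
      that is, (1 - m) w = (m d - c) v. As w is not a multiple of v, this forces m = 1; then v being
      nonzero gives c = d.\<close>
    have "inj_on (\<lambda>c. span {?x c}) (carrier K)"
    proof (rule inj_onI)
      fix c d assume cd: "c \<in> carrier K" "d \<in> carrier K" and eq: "span {?x c} = span {?x d}"
      have "?x c \<in> span {?x c}"
        using in_own_span[of "{?x c}"] cd v w by auto
      then obtain m where m: "m \<in> carrier K" "?x c = m \<odot>\<^bsub>V\<^esub> ?x d"
        unfolding eq using cd v w by (auto simp: span_singleton)
      have "w \<ominus>\<^bsub>V\<^esub> m \<odot>\<^bsub>V\<^esub> w = (m \<otimes>\<^bsub>K\<^esub> d) \<odot>\<^bsub>V\<^esub> v \<ominus>\<^bsub>V\<^esub> c \<odot>\<^bsub>V\<^esub> v"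
        using m cd v w
        by (intro M.add_eq_add_imp_minus_eq) (auto simp: smult_r_distr smult_assoc1)
      then have lin: "(\<one>\<^bsub>K\<^esub> \<ominus>\<^bsub>K\<^esub> m) \<odot>\<^bsub>V\<^esub> w = (m \<otimes>\<^bsub>K\<^esub> d \<ominus>\<^bsub>K\<^esub> c) \<odot>\<^bsub>V\<^esub> v"
        using m cd v w by (simp add: smult_diff_left)
      have "\<one>\<^bsub>K\<^esub> \<ominus>\<^bsub>K\<^esub> m = \<zero>\<^bsub>K\<^esub>"
      proof (rule ccontr)
        assume nz: "\<one>\<^bsub>K\<^esub> \<ominus>\<^bsub>K\<^esub> m \<noteq> \<zero>\<^bsub>K\<^esub>"
        let ?i = "inv\<^bsub>K\<^esub> (\<one>\<^bsub>K\<^esub> \<ominus>\<^bsub>K\<^esub> m)"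
        have i: "?i \<in> carrier K" using nz m field_Units by auto
        have "w = ?i \<odot>\<^bsub>V\<^esub> ((m \<otimes>\<^bsub>K\<^esub> d \<ominus>\<^bsub>K\<^esub> c) \<odot>\<^bsub>V\<^esub> v)"
          using mult_inverse[OF _ w(1) lin nz] m by simp
        also have "\<dots> = (?i \<otimes>\<^bsub>K\<^esub> (m \<otimes>\<^bsub>K\<^esub> d \<ominus>\<^bsub>K\<^esub> c)) \<odot>\<^bsub>V\<^esub> v"
          using i m cd v by (simp add: smult_assoc1)
        also have "\<dots> \<in> span {v}" using i m cd v by (auto simp: span_singleton)
        finally show False using w(2) by simp
      qed
      then have "m = \<one>\<^bsub>K\<^esub>" using m by simp
      then have "(d \<ominus>\<^bsub>K\<^esub> c) \<odot>\<^bsub>V\<^esub> v = \<zero>\<^bsub>V\<^esub>"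
        using lin cd v w by (simp add: R.minus_eq R.r_neg)
      then have "d \<ominus>\<^bsub>K\<^esub> c = \<zero>\<^bsub>K\<^esub>"
        using mult_inverse[of "d \<ominus>\<^bsub>K\<^esub> c" v] v cd field_Units by auto
      then show "c = d" using cd by simp
    qed
    moreover have "(\<lambda>c. span {?x c}) ` carrier K \<subseteq> {W. subspace K W V}"
      using v w by (auto intro!: span_is_subspace)
    ultimately show False
      using assms(1) fin by (meson finite_imageD finite_subset)
  qed
qed

end

text \<open>Being extensional, the families lie in the product, over finitely many vertices, of
  finite sets of subspaces.\<close>

lemma finite_subrepresentations:
  assumes "finite (verts Q)"
    and "\<And>a. a \<in> verts Q \<Longrightarrow> finite {W. VectorSpace.subspace K W (space_at M a)}"
  shows "finite (subrepresentations K Q M)"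
proof (rule finite_subset)
  show "subrepresentations K Q M \<subseteq> (\<Pi>\<^sub>E a \<in> verts Q. {W. VectorSpace.subspace K W (space_at M a)})"
    by (auto simp: subrepresentations_def PiE_def)
  show "finite \<dots>" using assms by (rule finite_PiE)
qed

text \<open>Acyclicity excludes cycles, which repeat no vertex except the endpoint; it extends to
  all nontrivial closed walks because each of these contains a cycle.\<close>

lemma (in wf_digraph) acyclic_quiver_irreflexive:
  assumes "acyclic_quiver G" and "a \<rightarrow>\<^sup>+ a"
  shows False
proof -
  obtain p where "awalk a p a" "p \<noteq> []" using assms(2) by (auto simp: reachable1_awalk)
  then show False
    using assms(1) closed_w_imp_cycle[of p] by (auto simp: acyclic_quiver_def closed_w_def)
qed

context representation
begin

definition extend_subspace :: "'a \<Rightarrow> 'v set \<Rightarrow> 'a \<Rightarrow> 'v set" where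
  "extend_subspace a U = (\<lambda>b \<in> verts Q.
     if b = a then U else if a \<rightarrow>\<^sup>+\<^bsub>Q\<^esub> b then carrier (space_at M b) else {\<zero>\<^bsub>space_at M b\<^esub>})"

text \<open>An arrow starting at a or at a vertex reachable from a ends where the family is the
  whole space; any other arrow starts at the zero space. Either way its map respects the family,
  whatever U is.\<close>

lemma extend_subspace_subrepresentation:
  assumes "acyclic_quiver Q" and a: "a \<in> verts Q"
    and U: "VectorSpace.subspace K U (space_at M a)"
  shows "extend_subspace a U \<in> subrepresentations K Q M"
  unfolding subrepresentations_def
proof (intro CollectI conjI ballI)
  show "extend_subspace a U \<in> extensional (verts Q)" by (simp add: extend_subspace_def)
next
  fix b assume "b \<in> verts Q"
  then show "VectorSpace.subspace K (extend_subspace a U b) (space_at M b)"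
    using U vectorspace.subspace_whole[OF vectorspace_at] vectorspace.subspace_zero[OF vectorspace_at]
    by (auto simp: extend_subspace_def)
next
  fix e assume e: "e \<in> arcs Q"
  interpret f: linear_map K "space_at M (tail Q e)" "space_at M (head Q e)" "map_at M e"
    using e by (rule linear_map_at)
  have Usub: "U \<subseteq> carrier (space_at M a)"
    using U by (auto simp: VectorSpace.subspace_def LinearCombinations.submodule_def)
  have verts: "tail Q e \<in> verts Q" "head Q e \<in> verts Q" using e by auto
  have arc: "tail Q e \<rightarrow>\<^bsub>Q\<^esub> head Q e" using e by (auto simp: arcs_ends_def arc_to_ends_def)
  show "map_at M e ` extend_subspace a U (tail Q e) \<subseteq> extend_subspace a U (head Q e)"
  proof (cases "a \<rightarrow>\<^sup>*\<^bsub>Q\<^esub> tail Q e")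
    case True
    then have reach: "a \<rightarrow>\<^sup>+\<^bsub>Q\<^esub> head Q e" using arc by (rule reachable_reachable1_trans[OF _ r_into_trancl])
    \<comment> \<open>Here acyclicity enters: an arrow returning to a would have to map into U,
      which need not hold.\<close>
    then have "head Q e \<noteq> a" using acyclic_quiver_irreflexive[OF assms(1)] by auto
    with reach verts have "extend_subspace a U (head Q e) = carrier (space_at M (head Q e))"
      by (simp add: extend_subspace_def)
    moreover have "extend_subspace a U (tail Q e) \<subseteq> carrier (space_at M (tail Q e))"
      using Usub verts by (auto simp: extend_subspace_def)
    ultimately show ?thesis by auto
  next
    case False
    then have "tail Q e \<noteq> a" "\<not> a \<rightarrow>\<^sup>+\<^bsub>Q\<^esub> tail Q e" using a by auto
    then have "extend_subspace a U (tail Q e) = {\<zero>\<^bsub>space_at M (tail Q e)\<^esub>}"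
      using verts by (simp add: extend_subspace_def)
    moreover have "\<zero>\<^bsub>space_at M (head Q e)\<^esub> \<in> extend_subspace a U (head Q e)"
      using U verts
      by (auto simp: extend_subspace_def VectorSpace.subspace_def LinearCombinations.submodule_def)
    ultimately show ?thesis by auto
  qed
qed

text \<open>The value of the extension at a recovers U, so distinct subspaces at a yield distinct
  subrepresentations.\<close>

lemma finite_subspaces_at:
  assumes "acyclic_quiver Q" and "finite (subrepresentations K Q M)" and a: "a \<in> verts Q"
  shows "finite {U. VectorSpace.subspace K U (space_at M a)}"
proof (rule inj_on_finite)
  show "inj_on (extend_subspace a) {U. VectorSpace.subspace K U (space_at M a)}"
  proof (rule inj_onI)
    fix U W assume "extend_subspace a U = extend_subspace a W"
    then have "extend_subspace a U a = extend_subspace a W a" by simp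
    then show "U = W" using a by (simp add: extend_subspace_def)
  qed
  show "extend_subspace a ` {U. VectorSpace.subspace K U (space_at M a)} \<subseteq> subrepresentations K Q M"
    using extend_subspace_subrepresentation[OF assms(1) a] by auto
qed (rule assms(2))

end

theorem proposition18:
  fixes K :: "('k, 'm) ring_scheme"
    and Q :: "('a, 'b) pre_digraph"
    and I :: "('a \<times> 'b list \<Rightarrow> 'k) set"
    and M :: "('a, 'b, 'k, 'v) quiver_rep"
  assumes "quiver Q" and "acyclic_quiver Q"
    and "field K" and "infinite (carrier K)"
    and "admissible_ideal K Q I"
    and "M \<in> rep K Q I"
  shows "finite (carrier (subrep_lattice K Q M)) \<longleftrightarrow> thin K Q M"
proof -
  interpret representation K Q M using assms(6) by (simp add: rep_def)
  \<comment> \<open>Finiteness of the lattice becomes a condition on each vertex separately, just as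
    thinness is, so that it can be decided one space at a time.\<close>
  have "finite (subrepresentations K Q M)
      \<longleftrightarrow> (\<forall>a \<in> verts Q. finite {U. VectorSpace.subspace K U (space_at M a)})"
    using finite_subspaces_at[OF assms(2)] finite_subrepresentations[of Q K M] finite_verts by blast
  also have "\<dots> \<longleftrightarrow> thin K Q M"
    using vectorspace.finite_subspaces_iff[OF vectorspace_at assms(4) fin_dim_at]
    by (auto simp: thin_def)
  finally show ?thesis by (simp add: subrep_lattice_def)
qed

end
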